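(* Let $m>2$ be an integer and let $h<m$ be a positive divisor of $m$ such that $m/h$ is even. Write $m=2e$. Put $q=2^m$, $D=\mathbb{F}_q^*$ and $$\mathcal{C}_{D}=\left\{\left(\mathrm{Tr}(x d^{2^h+1})\right)_{d\in D}: x\in\mathbb{F}_q\right\}.$$ Then $\mathcal{C}_{D}$ is a $[2^m-1,\,m]$ binary linear code whose weight distribution is as follows: weight $0$ has multiplicity $1$; weight $2^{m-1}-(-1)^{\frac{e}{h}}2^{e-1}$ has multiplicity $\frac{(2^m-1)2^h}{2^h+1}$; weight $2^{m-1}+(-1)^{\frac{e}{h}}2^{e+h-1}$ has multiplicity $\frac{2^m-1}{2^h+1}$; and there are no codewords of any other weight.
   Context: $\mathbb{F}_q$ is the finite field with $q=2^m$ elements, $\mathbb{F}_q^*$ its multiplicative group, and $\mathrm{Tr}:\mathbb{F}_q\to\mathbb{F}_2$ is the absolute trace. An $[n,k]$ binary linear code is a $k$-dimensional $\mathbb{F}_2$-subspace of $\mathbb{F}_2^n$; the (Hamming) weight of a codeword is its number of nonzero coordinates; the weight distribution records, for each $i$, the number of codewords of weight $i$ (the multiplicity of the weight $i$).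
   Formalization: The case h = e (that is, m = 2h) is excluded: there Tr(x d^(2^h+1)) = 0 for all x in the subfield with 2^h elements, so the code has dimension less than m and the second weight equals 0, and the claim is false. *)

theory Defs
  imports
    "HOL-Analysis.Cartesian_Space"
    "HOL-Computational_Algebra.Primes"
    "HOL-Library.Z2"
begin

text \<open>
  The absolute trace of the field with \<open>2 ^ m\<close> elements. The sum of the conjugates of \<open>x\<close> is an
  element of the prime field, that is, the image of a unique bit (see \<open>of_bit_abs_trace\<close>).
\<close>

definition abs_trace :: "nat \<Rightarrow> 'a :: finite_field \<Rightarrow> bit" where
  "abs_trace m x = (THE b. of_bit b = (\<Sum>i<m. x ^ (2 ^ i)))"

lemma of_bit_abs_trace:
  fixes x :: "'a :: finite_field"
  assumes "CARD('a) = 2 ^ m"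
  shows "of_bit (abs_trace m x) = (\<Sum>i<m. x ^ (2 ^ i))"
proof -
  define S where "S = (\<Sum>i<m. x ^ (2 ^ i))"
  have "(\<Sum>y\<in>(UNIV :: 'a set). y + 1) = (\<Sum>y\<in>UNIV. y)"
    by (rule sum.reindex_bij_witness[of _ "\<lambda>y. y - 1" "\<lambda>y. y + 1"]) auto
  then have "of_nat CARD('a) = (0 :: 'a)"
    by (simp add: sum.distrib)
  then have "CHAR('a) dvd 2 ^ m"
    unfolding of_nat_eq_0_iff_char_dvd assms(1) .
  moreover have p: "prime CHAR('a)"
    by (rule prime_CHAR_semidom) (simp add: finite_imp_CHAR_pos)
  ultimately have ch: "CHAR('a) = 2"
    by (metis prime_dvd_power primes_dvd_imp_eq two_is_prime_nat)
  have "S ^ 2 = (\<Sum>i<m. (x ^ (2 ^ i)) ^ 2)"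
    unfolding S_def by (rule freshmans_dream_sum) (use ch in simp_all)
  also have "\<dots> = (\<Sum>i<m. x ^ (2 ^ Suc i))"
    by (simp flip: power_mult add: mult.commute)
  also have "\<dots> = S"
  proof -
    have "x ^ (2 ^ m) = x"
      using finite_field_power_card_eq_same[of x] assms(1) by simp
    then show ?thesis
      using sum.lessThan_Suc_shift[of "\<lambda>i. x ^ (2 ^ i)" m] by (simp add: S_def add.commute)
  qed
  finally have "S * (S - 1) = 0" by (simp add: power2_eq_square algebra_simps)
  then have "S = 0 \<or> S = 1"
    using mult_eq_0_iff[of S "S - 1"] eq_iff_diff_eq_0[of S 1] by blast
  then have "\<exists>!b :: bit. of_bit b = S"
  proof
    assume "S = 0"
    then show ?thesis by (intro ex1I[of _ 0]) (auto simp: of_bool_def split: if_splits)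
  next
    assume "S = 1"
    then show ?thesis by (intro ex1I[of _ 1]) (auto simp: of_bool_def split: if_splits)
  qed
  from theI'[OF this] show ?thesis by (simp add: abs_trace_def S_def)
qed

definition linear_code :: "(bit ^ 'n) set \<Rightarrow> nat \<Rightarrow> nat \<Rightarrow> bool" where
  "linear_code C n k \<longleftrightarrow> CARD('n) = n \<and> vec.subspace C \<and> vec.dim C = k"

definition hamming_weight :: "bit ^ 'n \<Rightarrow> nat" where
  "hamming_weight c = card {j. c $ j \<noteq> 0}"

text \<open>
  Weights are taken as integers, so that formulas for them can use signs and subtraction.
\<close>

definition weight_multiplicity :: "(bit ^ 'n) set \<Rightarrow> int \<Rightarrow> nat" where
  "weight_multiplicity C w = card {c \<in> C. int (hamming_weight c) = w}"

text \<open>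
  The defining set \<open>D\<close> is given by the enumeration \<open>d\<close> of its elements by the coordinates.
\<close>

definition trace_code :: "nat \<Rightarrow> nat \<Rightarrow> ('n \<Rightarrow> 'a :: finite_field) \<Rightarrow> (bit ^ 'n) set" where
  "trace_code m h d = range (\<lambda>x. \<chi> j. abs_trace m (x * d j ^ (2 ^ h + 1)))"

end

theory Submission
  imports Defs "HOL-Computational_Algebra.Polynomial"
begin

text \<open>
  With \<open>N = 2 ^ h + 1\<close>, the weight of the codeword of \<open>x\<close> is \<open>(2 ^ m - S x) / 2\<close>, where \<open>S x\<close> is the
  character sum of \<open>x * y ^ N\<close> over the whole field. Since \<open>x * y ^ N\<close> is a quadratic form in \<open>y\<close>
  over the prime field, \<open>S x ^ 2\<close> is \<open>2 ^ m\<close> times a sum over the radical of its polar form. The radical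
  is trivial unless \<open>x\<close> is an \<open>N\<close>-th power, when it has \<open>2 ^ (2 * h)\<close> elements and \<open>S x = S 1\<close>.
  The sign of \<open>S 1\<close> follows from \<open>S 1 = 1\<close> modulo \<open>N\<close>; those of the other values follow from the
  vanishing of the sum of \<open>S x\<close> over all \<open>x \<noteq> 0\<close>.
\<close>

section \<open>Vector spaces over the field with two elements\<close>

text \<open>Each new independent vector doubles the span: since the only scalars are 0 and 1, the
  larger span is the disjoint union of the old one and its translate.\<close>

lemma card_span_bit:
  fixes B :: "(bit ^ 'n) set"
  assumes "finite B" "vec.independent B"
  shows "finite (vec.span B) \<and> card (vec.span B) = 2 ^ card B"
  using assms
proof (induction B rule: finite_induct)
  case empty
  then show ?case by simp
next
  case (insert a B)
  have ind: "vec.independent B" and a: "a \<notin> vec.span B"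
    using insert.prems insert.hyps(2) by (auto simp: vec.independent_insert)
  have scale: "k *s a = (if k = 0 then 0 else a)" for k :: bit
    by (cases k) auto
  have "vec.span (insert a B) = vec.span B \<union> (\<lambda>v. v + a) ` vec.span B"
  proof (intro equalityI subsetI)
    fix v assume "v \<in> vec.span (insert a B)"
    then obtain k :: bit where "v - k *s a \<in> vec.span B"
      by (auto simp: vec.span_breakdown_eq)
    then show "v \<in> vec.span B \<union> (\<lambda>v. v + a) ` vec.span B"
      by (cases "k = 0") (auto simp: scale intro!: image_eqI[of _ _ "v - a"])
  next
    fix v assume "v \<in> vec.span B \<union> (\<lambda>v. v + a) ` vec.span B"
    then show "v \<in> vec.span (insert a B)"
      by (auto intro: vec.span_base vec.span_add
          vec.span_mono[THEN subsetD, OF subset_insertI])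
  qed
  moreover have "vec.span B \<inter> (\<lambda>v. v + a) ` vec.span B = {}"
    using a vec.span_diff by fastforce
  moreover have "card ((\<lambda>v. v + a) ` vec.span B) = card (vec.span B)"
    by (intro card_image) (auto simp: inj_on_def)
  ultimately show ?case
    using insert.IH[OF ind] insert.hyps by (simp add: card_Un_disjoint)
qed

text \<open>Lets the dimension of the code be read off from its number of codewords.\<close>

lemma card_subspace_bit:
  fixes C :: "(bit ^ 'n) set"
  assumes "vec.subspace C" "finite C"
  shows "card C = 2 ^ vec.dim C"
proof -
  obtain B where "B \<subseteq> C" "vec.independent B" "C \<subseteq> vec.span B" "card B = vec.dim C"
    by (rule vec.basis_exists)
  moreover have "finite B"
    using \<open>B \<subseteq> C\<close> assms(2) by (rule finite_subset)
  moreover have "vec.span B = C"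
    using calculation assms by (simp add: vec.span_subspace)
  ultimately show ?thesis
    using card_span_bit[of B] by simp
qed

section \<open>Powers in finite fields\<close>

lemma power_minus_1_dvd: "(a - 1 :: nat) dvd a ^ k - 1"
proof (cases "a = 0")
  case False
  then have "int (a - 1) dvd int (a ^ k - 1)"
    using power_diff_1_eq[of "int a" k] by (simp add: of_nat_diff)
  then show ?thesis by (simp only: int_dvd_int_iff)
qed (simp add: power_0_left)

lemma card_power_eq_le:
  fixes z :: "'a :: finite_field"
  assumes "k > 0"
  shows "card {y. y ^ k = z} \<le> k"
proof -
  define p where "p = monom 1 k - [:z:]"
  have "coeff p k = 1"
    using assms by (simp add: p_def coeff_pCons split: nat.split)
  then have "p \<noteq> 0" by auto
  moreover have "degree p \<le> k"
    unfolding p_def by (rule degree_diff_le) (auto simp: degree_monom_le)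
  ultimately show ?thesis
    using card_poly_roots_bound[of p] by (simp add: p_def poly_monom)
qed

lemma power_card_minus_1:
  fixes x :: "'a :: finite_field"
  assumes "x \<noteq> 0"
  shows "x ^ (CARD('a) - 1) = 1"
proof -
  have "x * x ^ (CARD('a) - 1) = x * 1"
    using finite_field_power_card_eq_same[of x] finite_UNIV_card_ge_0[where ?'a = 'a]
    by (simp flip: power_Suc)
  then show ?thesis using assms by (simp del: mult_1_right)
qed

text \<open>Double counting: the fibres of \<open>y ^ k\<close> over the \<open>l\<close>-th roots
  of unity partition the \<open>k * l\<close> nonzero elements. There are at most \<open>l\<close>
  such roots and at most \<open>k\<close> elements in each fibre, so both bounds are
  attained.\<close>

lemma
  fixes k l :: nat
  assumes kl: "k * l = CARD('a :: finite_field) - 1" and "k * l > 0"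
  shows card_power_eq_1: "card {z :: 'a. z ^ l = 1} = l"
    and card_power_eq: "z ^ l = 1 \<Longrightarrow> card {y :: 'a. y ^ k = z} = k"
proof -
  define P where "P = {z :: 'a. z ^ l = 1}"
  have pos: "k > 0" "l > 0" using assms(2) by auto
  have P: "card P \<le> l"
    unfolding P_def using pos by (intro card_power_eq_le)
  have "y ^ k \<in> P \<longleftrightarrow> y \<noteq> 0" for y
  proof -
    have "(y ^ k) ^ l = y ^ (CARD('a) - 1)" by (simp only: kl flip: power_mult)
    then show ?thesis
      using power_card_minus_1[of y] pos by (auto simp: P_def power_0_left)
  qed
  then have "(\<Union>z\<in>P. {y. y ^ k = z}) = UNIV - {0}" by auto
  then have "k * l = card (\<Union>z\<in>P. {y. y ^ k = z})"
    using kl by (simp add: card_Diff_singleton)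
  also have "\<dots> = (\<Sum>z\<in>P. card {y. y ^ k = z})"
    by (rule card_UN_disjoint) auto
  finally have sum: "(\<Sum>z\<in>P. card {y. y ^ k = z}) = k * l" ..
  have "k * l \<le> (\<Sum>z\<in>P. k)"
    unfolding sum[symmetric] using pos by (intro sum_mono card_power_eq_le)
  then have "card P = l"
    using P pos by simp
  then show "card {z :: 'a. z ^ l = 1} = l"
    by (simp add: P_def)
  assume "z ^ l = 1"
  then have "z \<in> P" by (simp add: P_def)
  with sum \<open>card P = l\<close> pos show "card {y. y ^ k = z} = k"
    by (intro sum_mono_inv[of "\<lambda>z. card {y. y ^ k = z}" P "\<lambda>_. k" z] card_power_eq_le) auto
qed

section \<open>Fields of characteristic two and their additive character\<close>

locale binary_field =
  fixes m :: nat and ty :: "'a :: finite_field itself"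
  assumes card_UNIV: "CARD('a) = 2 ^ m"
begin

lemma card_gt_1: "CARD('a) > 1"
  using card_mono[of UNIV "{0, 1 :: 'a}"] by simp

lemma m_pos: "m > 0"
  using card_gt_1 card_UNIV by (cases m) auto

lemma power_card [simp]: "(x :: 'a) ^ (2 ^ m) = x"
  using finite_field_power_card_eq_same[of x] by (simp add: card_UNIV)

lemma two_eq_0: "(2 :: 'a) = 0"
proof -
  have "(- 1 :: 'a) = (- 1) ^ (2 ^ m)" by (rule power_card[symmetric])
  also have "\<dots> = 1" using m_pos by (simp del: power_card)
  finally have "(1 :: 'a) + 1 = 0" by (metis add.right_inverse)
  then show ?thesis by (simp only: one_add_one)
qed

lemma add_self [simp]: "(x :: 'a) + x = 0"
  using two_eq_0 by (simp flip: mult_2)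

lemma CHAR_eq_2: "CHAR('a) = 2"
proof -
  have "CHAR('a) dvd 2"
    using two_eq_0 of_nat_eq_0_iff_char_dvd[where ?'a = 'a, of 2] by simp
  moreover have "prime CHAR('a)"
    by (rule prime_CHAR_semidom) (simp add: finite_imp_CHAR_pos)
  ultimately show ?thesis
    by (simp add: primes_dvd_imp_eq)
qed

lemma frob_add: "((x :: 'a) + y) ^ (2 ^ n) = x ^ (2 ^ n) + y ^ (2 ^ n)"
  by (rule freshmans_dream') (simp_all add: CHAR_eq_2)

lemma frob_inj: "n \<le> m \<Longrightarrow> inj (\<lambda>x :: 'a. x ^ (2 ^ n))"
proof (rule inj_on_inverseI)
  fix x :: 'a assume "n \<le> m"
  then show "(x ^ (2 ^ n)) ^ (2 ^ (m - n)) = x"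
    by (simp flip: power_mult power_add)
qed

text \<open>The character \<open>(-1)^Tr(x)\<close>, with integer values so that its sums can be
  studied modulo \<open>2 ^ h + 1\<close>.\<close>

definition chi :: "'a \<Rightarrow> int" where
  "chi x = (if abs_trace m x = 0 then 1 else - 1)"

lemma abs_trace_eq_0_iff: "abs_trace m (x :: 'a) = 0 \<longleftrightarrow> (\<Sum>i<m. x ^ (2 ^ i)) = 0"
  using of_bit_abs_trace[OF card_UNIV, of x] by (cases "abs_trace m x") auto

lemma abs_trace_add: "abs_trace m (x + y :: 'a) = abs_trace m x + abs_trace m y"
proof -
  have "(of_bit (abs_trace m (x + y)) :: 'a) = of_bit (abs_trace m x) + of_bit (abs_trace m y)"
    unfolding of_bit_abs_trace[OF card_UNIV] by (simp add: frob_add sum.distrib)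
  then show ?thesis
    by (cases "abs_trace m x"; cases "abs_trace m y"; cases "abs_trace m (x + y)") simp_all
qed

lemma chi_0 [simp]: "chi 0 = 1"
  by (simp add: chi_def abs_trace_eq_0_iff power_0_left)

lemma chi_add: "chi (x + y) = chi x * chi y"
  by (cases "abs_trace m x"; cases "abs_trace m y") (auto simp: chi_def abs_trace_add)

lemma chi_square [simp]: "chi (x ^ 2) = chi x"
proof -
  have "(\<Sum>i<m. (x ^ 2) ^ (2 ^ i)) = (\<Sum>i<m. x ^ (2 ^ Suc i))"
    by (simp flip: power_mult)
  also have "\<dots> = (\<Sum>i<m. x ^ (2 ^ i))"
    using sum.lessThan_Suc_shift[of "\<lambda>i. x ^ (2 ^ i)" m] by (simp add: add.commute)
  finally show ?thesis
    by (simp add: chi_def abs_trace_eq_0_iff)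
qed

lemma chi_frob [simp]: "chi (x ^ (2 ^ n)) = chi x"
proof (induction n)
  case (Suc n)
  have "x ^ (2 ^ Suc n) = (x ^ (2 ^ n)) ^ 2"
    by (simp flip: power_mult add: mult.commute)
  with Suc show ?case by simp
qed simp

text \<open>On the subfield of index two the conjugates repeat with period \<open>e\<close>, so the
  two halves of the trace cancel.\<close>

lemma chi_eq_1_of_even_degree:
  assumes "m = 2 * e" "x ^ (2 ^ e) = x"
  shows "chi x = 1"
proof -
  have "(\<Sum>i<m. x ^ (2 ^ i)) = (\<Sum>i<e. x ^ (2 ^ i)) + (\<Sum>i<e. x ^ (2 ^ (e + i)))"
    using assms(1) sum.nat_group[of "\<lambda>i. x ^ (2 ^ i)" e 2]
    by (simp add: numeral_2_eq_2 mult.commute atLeast0LessThan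
        sum.atLeastLessThan_shift_0[of _ e "e + e"] add.commute)
  also have "(\<Sum>i<e. x ^ (2 ^ (e + i))) = (\<Sum>i<e. x ^ (2 ^ i))"
    using assms(2) by (simp add: power_add power_mult)
  finally show ?thesis
    by (simp add: chi_def abs_trace_eq_0_iff)
qed

text \<open>The trace is a nonzero polynomial of degree below the field size, so it cannot vanish
  everywhere.\<close>

lemma chi_nontrivial: "\<exists>x. chi x = - 1"
proof (rule ccontr)
  assume *: "\<nexists>x. chi x = - 1"
  define p where "p = (\<Sum>i<m. monom (1 :: 'a) (2 ^ i))"
  have "poly p x = 0" for x
    using * by (auto simp: p_def poly_sum poly_monom chi_def abs_trace_eq_0_iff split: if_splits)
  then have "card {x. poly p x = 0} = 2 ^ m"
    by (simp add: card_UNIV)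
  moreover have "degree p \<le> 2 ^ (m - 1)"
    unfolding p_def
    by (intro degree_sum_le) (auto intro!: order.trans[OF degree_monom_le] power_increasing)
  \<comment> \<open>Only the summand \<open>i = 0\<close> has degree 1.\<close>
  moreover have "coeff p 1 = 1"
    using m_pos by (simp add: p_def coeff_sum sum.delta if_distrib cong: if_cong)
  moreover from this have "p \<noteq> 0" by auto
  ultimately have "(2 :: nat) ^ m \<le> 2 ^ (m - 1)"
    using card_poly_roots_bound[of p] by linarith
  then show False using m_pos by simp
qed

lemma sum_chi: "(\<Sum>x\<in>UNIV. chi x) = 0"
proof -
  obtain a where a: "chi a = - 1" using chi_nontrivial by blast
  have "(\<Sum>x\<in>UNIV. chi x) = (\<Sum>x\<in>UNIV. chi (x + a))"
    by (rule sum.reindex_bij_witness[of _ "\<lambda>x. x + a" "\<lambda>x. x - a"]) auto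
  then show ?thesis by (simp add: chi_add a sum_negf)
qed

lemma sum_chi_mult: "(\<Sum>x\<in>UNIV. chi (a * x)) = (if a = 0 then 2 ^ m else 0)"
proof (cases "a = 0")
  case True
  then show ?thesis using card_UNIV by simp
next
  case False
  then have "(\<Sum>x\<in>UNIV. chi (a * x)) = (\<Sum>x\<in>UNIV. chi x)"
    by (intro sum.reindex_bij_witness[of _ "\<lambda>x. x / a" "\<lambda>x. a * x"]) auto
  with False show ?thesis by (simp add: sum_chi)
qed

section \<open>Character sums of power maps\<close>

definition char_sum :: "nat \<Rightarrow> 'a \<Rightarrow> int" where
  "char_sum n x = (\<Sum>y\<in>UNIV. chi (x * y ^ n))"

lemma char_sum_0: "char_sum n 0 = 2 ^ m"
  using card_UNIV by (simp add: char_sum_def)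

text \<open>Rescaling \<open>y\<close> by \<open>c\<close> shows that the sum depends only on the
  class of \<open>x\<close> modulo nonzero \<open>n\<close>-th powers.\<close>

lemma char_sum_mult_power:
  assumes "c \<noteq> 0"
  shows "char_sum n (x * c ^ n) = char_sum n x"
  unfolding char_sum_def
  by (rule sum.reindex_bij_witness[of _ "\<lambda>y. y / c" "\<lambda>y. c * y"])
    (use assms in \<open>auto simp: power_mult_distrib mult_ac\<close>)

text \<open>After exchanging the sums, orthogonality leaves only \<open>y = 0\<close>.\<close>

lemma sum_char_sum:
  assumes "n > 0"
  shows "(\<Sum>x\<in>UNIV. char_sum n x) = 2 ^ m"
proof -
  have "(\<Sum>x\<in>UNIV. char_sum n x) = (\<Sum>y\<in>UNIV. \<Sum>x\<in>UNIV. chi (y ^ n * x))"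
    unfolding char_sum_def by (subst sum.swap) (simp add: mult.commute)
  also have "\<dots> = 2 ^ m"
    using assms by (simp add: sum_chi_mult)
  finally show ?thesis .
qed

text \<open>
  Substituting \<open>z = y + u\<close> in the double sum over \<open>y\<close> and \<open>z\<close> makes the argument of the character
  additive in \<open>y\<close>, so only the radical of the associated bilinear form contributes.
\<close>

lemma char_sum_square:
  assumes "h \<le> m"
  shows "char_sum (2 ^ h + 1) x ^ 2 =
    2 ^ m * (\<Sum>u | x * u + (x * u ^ (2 ^ h)) ^ (2 ^ h) = 0. chi (x * u ^ (2 ^ h + 1)))"
proof -
  define H :: nat where "H = 2 ^ h"
  define L where "L u = x * u + (x * u ^ H) ^ H" for u
  \<comment> \<open>As \<open>chi\<close> is Frobenius-invariant, the second polar term may be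
    raised to the power \<open>H\<close>; both terms are then multiples of \<open>y ^ H\<close>, and
    \<open>L\<close> collects the coefficients.\<close>
  have cross: "chi (x * (y ^ H * u)) * chi (x * (y * u ^ H)) = chi (L u * y ^ H)" for y u
  proof -
    have "chi (x * (y * u ^ H)) = chi ((x * (y * u ^ H)) ^ H)"
      by (simp add: H_def)
    also have "\<dots> = chi ((x * u ^ H) ^ H * y ^ H)"
      by (simp add: power_mult_distrib mult_ac)
    finally have "chi (x * (y ^ H * u)) * chi (x * (y * u ^ H)) =
        chi (x * u * y ^ H + (x * u ^ H) ^ H * y ^ H)"
      unfolding chi_add by (simp add: mult_ac)
    then show ?thesis by (simp add: L_def distrib_right)
  qed
  have expand: "chi (x * y ^ (H + 1)) * chi (x * (y + u) ^ (H + 1)) =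
      chi (x * u ^ (H + 1)) * chi (L u * y ^ H)" for y u
  proof -
    have "x * y ^ (H + 1) + x * (y + u) ^ (H + 1) =
        x * u ^ (H + 1) + (x * (y ^ H * u) + x * (y * u ^ H)) + (x * y ^ (H + 1) + x * y ^ (H + 1))"
      using frob_add[of y u h] by (simp add: H_def algebra_simps del: add_self)
    then have "x * y ^ (H + 1) + x * (y + u) ^ (H + 1) =
        x * u ^ (H + 1) + (x * (y ^ H * u) + x * (y * u ^ H))"
      by (simp del: power_add power_Suc add: add_self)
    then show ?thesis
      by (simp only: cross flip: chi_add) (simp only: chi_add cross)
  qed
  \<comment> \<open>Hence \<open>y ^ H\<close> runs over the whole field and orthogonality applies
    to the inner sum.\<close>
  have bij: "bij (\<lambda>y :: 'a. y ^ H)"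
    using frob_inj[OF assms] finite_UNIV_inj_surj[OF _ frob_inj[OF assms]]
    by (simp add: H_def bij_def)
  have "char_sum (H + 1) x ^ 2 =
      (\<Sum>y\<in>UNIV. \<Sum>z\<in>UNIV. chi (x * y ^ (H + 1)) * chi (x * z ^ (H + 1)))"
    by (simp only: power2_eq_square char_sum_def sum_product)
  also have "\<dots> = (\<Sum>y\<in>UNIV. \<Sum>u\<in>UNIV. chi (x * y ^ (H + 1)) * chi (x * (y + u) ^ (H + 1)))"
  proof (rule sum.cong[OF refl])
    fix y
    show "(\<Sum>z\<in>UNIV. chi (x * y ^ (H + 1)) * chi (x * z ^ (H + 1))) =
        (\<Sum>u\<in>UNIV. chi (x * y ^ (H + 1)) * chi (x * (y + u) ^ (H + 1)))"
      by (rule sum.reindex_bij_witness[of _ "\<lambda>u. y + u" "\<lambda>z. z - y"]) auto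
  qed
  also have "\<dots> = (\<Sum>u\<in>UNIV. chi (x * u ^ (H + 1)) * (\<Sum>y\<in>UNIV. chi (L u * y ^ H)))"
    unfolding expand by (subst sum.swap) (simp only: sum_distrib_left)
  also have "\<dots> = (\<Sum>u\<in>UNIV. chi (x * u ^ (H + 1)) * (if L u = 0 then 2 ^ m else 0))"
    using sum.reindex_bij_betw[OF bij, of "\<lambda>z. chi (L _ * z)"] by (simp only: sum_chi_mult)
  also have "\<dots> = 2 ^ m * (\<Sum>u | L u = 0. chi (x * u ^ (H + 1)))"
    by (simp add: sum_distrib_left mult.commute sum.If_cases if_distrib[of "(*) _"]
        cong: if_cong)
  finally show ?thesis by (simp add: H_def L_def)
qed

section \<open>Squares of the sums at 1 and at non-powers\<close>

lemma power_fixed: "(x :: 'a) ^ n = x \<Longrightarrow> x ^ (n ^ k) = x"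
  by (induction k) (simp_all add: power_mult)

text \<open>For \<open>x = 1\<close> the radical is the subfield of order
  \<open>2 ^ (2 * h)\<close>, and \<open>chi\<close> is 1 at each \<open>u ^ (2 ^ h + 1)\<close>
  with \<open>u\<close> in it, so the radical contributes its cardinality.\<close>

lemma char_sum_1_square:
  assumes m: "m = 2 * (h * k)" and "h > 0" "k > 0"
  shows "char_sum (2 ^ h + 1) 1 ^ 2 = 2 ^ (m + 2 * h)"
proof -
  define H :: nat where "H = 2 ^ h"
  have H: "H \<ge> 2"
    using power_increasing[of 1 h "2 :: nat"] assms by (simp add: H_def)
  then have HH: "H * H > 1"
    using mult_le_mono[of 2 H 2 H] by simp
  have hm: "h \<le> m" using assms by (cases k) auto
  have "2 ^ m = (H * H) ^ k"
    by (simp add: m H_def mult.commute mult_2 flip: power_mult power_add)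
  then obtain l where "2 ^ m - 1 = (H * H - 1) * l"
    using power_minus_1_dvd[of "H * H" k] by auto
  then have l: "l * (H * H - 1) = CARD('a) - 1"
    by (simp add: card_UNIV mult.commute)
  then have "l * (H * H - 1) > 0"
    using card_gt_1 by linarith
  with l have card_roots: "card {z :: 'a. z ^ (H * H - 1) = 1} = H * H - 1"
    by (rule card_power_eq_1)
  define K where "K = {u :: 'a. 1 * u + (1 * u ^ H) ^ H = 0}"
  have K_iff: "u \<in> K \<longleftrightarrow> u ^ (H * H) = u" for u
  proof -
    have "u + u ^ (H * H) = 0 \<longleftrightarrow> u ^ (H * H) = u"
      by (metis add_self add_left_cancel)
    then show ?thesis by (simp add: K_def power_mult)
  qed
  have "u \<in> K \<longleftrightarrow> u = 0 \<or> u ^ (H * H - 1) = 1" for u :: 'a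
  proof -
    have "u ^ (H * H) = u ^ (H * H - 1) * u"
      by (rule power_minus_mult[symmetric]) (use HH in linarith)
    then show ?thesis by (simp add: K_iff)
  qed
  then have "K = insert 0 {z. z ^ (H * H - 1) = 1}" by blast
  moreover have "(0 :: 'a) \<notin> {z. z ^ (H * H - 1) = 1}"
    using HH by (simp add: power_0_left)
  ultimately have "card K = H * H"
    using card_roots HH by simp
  moreover have "chi (1 * u ^ (H + 1)) = 1" if "u \<in> K" for u
  proof -
    \<comment> \<open>This is the norm of \<open>u\<close> to the subfield of order
      \<open>H\<close>, which lies in the subfield of order \<open>2 ^ (h * k)\<close>, where the
      trace vanishes.\<close>
    have "(u ^ (H + 1)) ^ H = u ^ (H + 1)"
      using that by (simp add: K_iff power_mult_distrib mult.commute flip: power_mult)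
    then have "(u ^ (H + 1)) ^ (H ^ k) = u ^ (H + 1)"
      by (rule power_fixed)
    then have "(u ^ (H + 1)) ^ (2 ^ (h * k)) = u ^ (H + 1)"
      by (simp only: H_def power_mult)
    then show ?thesis
      unfolding mult_1 by (rule chi_eq_1_of_even_degree[OF m])
  qed
  ultimately have "(\<Sum>u\<in>K. chi (1 * u ^ (H + 1))) = int (H * H)"
    by simp
  then show ?thesis
    using char_sum_square[OF hm, of 1]
    by (simp add: K_def H_def power_add mult_2 del: power_Suc)
qed

text \<open>A nonzero \<open>u\<close> in the radical would put \<open>x * u ^ (2 ^ h + 1)\<close>
  in the subfield of order \<open>2 ^ h\<close>. All elements there are
  \<open>(2 ^ h + 1)\<close>-th powers, so \<open>x\<close> would be one too.\<close>

lemma char_sum_non_power_square: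
  assumes "h \<le> m" "0 < h" "x \<noteq> 0" and non_power: "\<And>c. x \<noteq> c ^ (2 ^ h + 1)"
  shows "char_sum (2 ^ h + 1) x ^ 2 = 2 ^ m"
proof -
  define H :: nat where "H = 2 ^ h"
  have "\<not> x * u + (x * u ^ H) ^ H = 0" if "u \<noteq> 0" for u
  proof
    assume u: "x * u + (x * u ^ H) ^ H = 0"
    define b where "b = x * u ^ (H + 1)"
    have "(x * u ^ H) ^ H = x * u"
      using u by (metis add_self add_left_cancel)
    moreover have "b = (x * u ^ H) * u"
      by (simp add: b_def)
    ultimately have "b ^ H = b"
      by (simp only: power_mult_distrib[of "x * u ^ H" u]) (simp add: mult_ac)
    \<comment> \<open>Elements of the subfield of order \<open>H\<close> are squares \<open>c * c = c ^ (H + 1)\<close>.\<close>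
    define c where "c = b ^ (2 ^ (h - 1))"
    have "2 ^ (h - 1) * 2 = H"
      using \<open>0 < h\<close> by (cases h) (simp_all add: H_def)
    then have "c ^ 2 = b ^ H"
      by (simp add: c_def flip: power_mult)
    moreover have "c ^ H = (b ^ H) ^ (2 ^ (h - 1))"
      unfolding c_def by (simp only: mult.commute flip: power_mult)
    ultimately have "c ^ (H + 1) = b"
      unfolding \<open>b ^ H = b\<close> c_def[symmetric] by (simp add: power2_eq_square)
    then have "x = (c / u) ^ (H + 1)"
      unfolding power_divide using \<open>u \<noteq> 0\<close> b_def by simp
    then show False
      using non_power unfolding H_def by blast
  qed
  moreover have "x * 0 + (x * 0 ^ H) ^ H = 0"
    by (simp add: H_def power_0_left)
  ultimately have "{u. x * u + (x * u ^ H) ^ H = 0} = {0}" by blast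
  then show ?thesis
    using char_sum_square[OF \<open>h \<le> m\<close>, of x] by (simp add: H_def)
qed

section \<open>Signs and values of the sums\<close>

lemma card_non_powers:
  assumes M: "(2 ^ h + 1) * M = 2 ^ m - (1 :: nat)"
  shows "card (UNIV - {0} - {z :: 'a. z ^ M = 1}) = 2 ^ h * M"
proof -
  define P where "P = {z :: 'a. z ^ M = 1}"
  have NM: "(2 ^ h + 1) * M = CARD('a) - 1" using M by (simp add: card_UNIV)
  have pos: "(2 ^ h + 1) * M > 0" using NM card_gt_1 by simp
  have "card P = M"
    unfolding P_def by (rule card_power_eq_1[OF NM pos])
  moreover have "P \<subseteq> UNIV - {0}"
    using pos by (auto simp: P_def power_0_left)
  moreover have "card (UNIV - {0 :: 'a}) = (2 ^ h + 1) * M"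
    unfolding NM by (simp add: card_Diff_singleton)
  ultimately have "card (UNIV - {0} - P) = (2 ^ h + 1) * M - M"
    by (simp only: card_Diff_subset finite)
  then show ?thesis by (simp add: P_def algebra_simps)
qed

text \<open>
  The sign of the character sum at \<open>1\<close> comes from a congruence modulo \<open>2 ^ h + 1\<close>: the map
  \<open>y \<mapsto> y ^ (2 ^ h + 1)\<close> is \<open>(2 ^ h + 1)\<close>-to-one on nonzero elements and \<open>2 ^ h\<close> is \<open>- 1\<close> modulo \<open>2 ^ h + 1\<close>.
\<close>

lemma char_sum_1:
  assumes m: "m = 2 * (h * k)" and "h > 0" "k > 0" and M: "(2 ^ h + 1) * M = 2 ^ m - (1 :: nat)"
  shows "char_sum (2 ^ h + 1) 1 = - ((- 1) ^ k * 2 ^ (h * k + h))"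
proof -
  define N :: nat where "N = 2 ^ h + 1"
  define P where "P = {z :: 'a. z ^ M = 1}"
  have NM: "N * M = CARD('a) - 1" using M by (simp add: N_def card_UNIV)
  have NM_pos: "N * M > 0" using NM card_gt_1 by simp
  have "(y ^ N) ^ M = 1 \<longleftrightarrow> y \<noteq> 0" for y :: 'a
    using power_card_minus_1[of y] NM_pos by (auto simp: NM power_0_left simp flip: power_mult)
  then have img: "(\<lambda>y. y ^ N) ` (UNIV - {0}) \<subseteq> P" and fib: "\<And>y. y ^ N \<in> P \<longleftrightarrow> y \<noteq> 0"
    by (auto simp: P_def)
  have "(\<Sum>y\<in>UNIV - {0}. chi (y ^ N)) = (\<Sum>z\<in>P. \<Sum>y\<in>{y \<in> UNIV - {0}. y ^ N = z}. chi (y ^ N))"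
    by (rule sum.group[symmetric]) (use img in auto)
  also have "\<dots> = (\<Sum>z\<in>P. int N * chi z)"
  proof (rule sum.cong[OF refl])
    fix z assume "z \<in> P"
    then have "{y \<in> UNIV - {0}. y ^ N = z} = {y. y ^ N = z}"
      using fib by auto
    moreover have "card {y. y ^ N = z} = N"
      using card_power_eq[OF NM NM_pos] \<open>z \<in> P\<close> by (simp add: P_def)
    ultimately show "(\<Sum>y\<in>{y \<in> UNIV - {0}. y ^ N = z}. chi (y ^ N)) = int N * chi z"
      by simp
  qed
  finally have "char_sum N 1 = 1 + int N * (\<Sum>z\<in>P. chi z)"
    using NM_pos
    by (simp add: char_sum_def sum.remove[of UNIV 0] power_0_left sum_distrib_left)
  then have cong1: "int N dvd char_sum N 1 - 1" by simp
  have "int N dvd (2 ^ h) ^ (k + 1) - (- 1) ^ (k + 1)"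
  proof -
    have "(2 ^ h - (- 1 :: int)) dvd (2 ^ h) ^ (k + 1) - (- 1) ^ (k + 1)"
      by (simp only: power_diff_sumr2 dvd_triv_left)
    moreover have "int N = 2 ^ h - (- 1)" by (simp add: N_def)
    ultimately show ?thesis by (simp only:)
  qed
  then have cong2: "int N dvd 2 ^ (h * k + h) + (- 1) ^ k"
    by (simp add: power_add mult.commute flip: power_mult)
  \<comment> \<open>The wrong sign would make \<open>2\<close> the difference of two multiples of
    \<open>N\<close>, but \<open>N\<close> is at least 3.\<close>
  have N: "\<not> int N dvd 2"
  proof
    assume "int N dvd 2"
    then have "int N \<le> 2" by (rule zdvd_imp_le) simp
    then show False
      using power_increasing[of 1 h "2 :: int"] \<open>h > 0\<close> by (simp add: N_def)
  qed
  have "char_sum N 1 ^ 2 = (2 ^ (h * k + h)) ^ 2"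
    using char_sum_1_square[OF assms(1-3)] by (simp add: N_def m algebra_simps flip: power_mult)
  then consider "char_sum N 1 = - ((- 1) ^ k * 2 ^ (h * k + h))"
    | "char_sum N 1 = (- 1) ^ k * 2 ^ (h * k + h)"
    by (cases "even k") (auto simp: power2_eq_iff)
  then show ?thesis
  proof cases
    case 2
    have "int N dvd (- 1) ^ k * (2 ^ (h * k + h) + (- 1) ^ k) - (char_sum N 1 - 1)"
      by (rule dvd_diff[OF dvd_mult[OF cong2] cong1])
    also have "(- 1) ^ k * (2 ^ (h * k + h) + (- 1) ^ k) - (char_sum N 1 - 1) = 2"
      unfolding 2 by (cases "even k") simp_all
    finally show ?thesis using N by contradiction
  qed (simp add: N_def)
qed

text \<open>
  The sum over the nonzero arguments vanishes, and the contribution of the non-powers has to be as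
  large as their absolute values permit; so all of them have the same sign.
\<close>

lemma char_sum_eq:
  assumes m: "m = 2 * (h * k)" and "h > 0" "k > 0" and M: "(2 ^ h + 1) * M = 2 ^ m - (1 :: nat)"
    and "x \<noteq> 0"
  shows "char_sum (2 ^ h + 1) x =
    (if x ^ M = 1 then - ((- 1) ^ k * 2 ^ (h * k + h)) else (- 1) ^ k * 2 ^ (h * k))"
proof -
  define N :: nat where "N = 2 ^ h + 1"
  define P where "P = {z :: 'a. z ^ M = 1}"
  define s :: int where "s = (- 1) ^ k"
  have ss: "s * s = 1" by (simp add: s_def flip: power_mult_distrib)
  have NM: "N * M = CARD('a) - 1" using M by (simp add: N_def card_UNIV)
  have NM_pos: "N * M > 0" using NM card_gt_1 by simp
  have hm: "h \<le> m" using assms by (cases k) auto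
  have "0 \<notin> P" using NM_pos by (auto simp: P_def power_0_left)
  have card_P: "card P = M"
    unfolding P_def by (rule card_power_eq_1[OF NM NM_pos])
  have power: "char_sum N z = - (s * 2 ^ (h * k + h))" if "z \<in> P" for z
  proof -
    have "card {y. y ^ N = z} = N"
      using card_power_eq[OF NM NM_pos] that by (simp add: P_def)
    \<comment> \<open>So every element of \<open>P\<close> is an \<open>N\<close>-th power, and its
      sum equals the one at 1.\<close>
    then have "{y. y ^ N = z} \<noteq> {}" by (metis card.empty NM_pos mult_is_0 less_irrefl)
    then obtain c where "z = c ^ N" by blast
    with that \<open>0 \<notin> P\<close> have "c \<noteq> 0" by (auto simp: N_def)
    then show ?thesis
      using char_sum_mult_power[of c N 1] char_sum_1[OF assms(1-4)] \<open>z = c ^ N\<close>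
      by (simp add: N_def s_def)
  qed
  define Q where "Q = UNIV - {0} - P"
  have card_Q: "card Q = 2 ^ h * M"
    unfolding Q_def P_def by (rule card_non_powers[OF M])
  have le: "s * char_sum N z \<le> 2 ^ (h * k)" if "z \<in> Q" for z
  proof -
    have "z \<noteq> c ^ N" for c
    proof
      assume "z = c ^ N"
      with that have "c \<noteq> 0" by (auto simp: Q_def N_def)
      then show False
        using that power_card_minus_1[of c] \<open>z = c ^ N\<close>
        by (simp add: Q_def P_def NM flip: power_mult)
    qed
    then have "char_sum N z ^ 2 = 2 ^ m"
      unfolding N_def using that assms(2) hm
      by (intro char_sum_non_power_square) (auto simp: Q_def)
    then have "(s * char_sum N z) ^ 2 = (2 ^ (h * k)) ^ 2"
      using ss by (simp add: m power_mult_distrib power2_eq_square[of s] mult.commute flip: power_mult)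
    then show ?thesis by (auto simp: power2_eq_iff)
  qed
  have "(\<Sum>z\<in>UNIV. char_sum N z) = char_sum N 0 + (\<Sum>z\<in>UNIV - {0}. char_sum N z)"
    by (rule sum.remove) auto
  also have "(\<Sum>z\<in>UNIV - {0}. char_sum N z) = (\<Sum>z\<in>Q. char_sum N z) + (\<Sum>z\<in>P. char_sum N z)"
    unfolding Q_def using \<open>0 \<notin> P\<close> by (intro sum.subset_diff) auto
  also have "(\<Sum>z\<in>P. char_sum N z) = - (s * (2 ^ (h * k + h) * int M))"
    by (simp add: power card_P)
  finally have "(\<Sum>z\<in>Q. char_sum N z) = s * (2 ^ (h * k + h) * int M)"
    by (simp add: sum_char_sum char_sum_0 N_def)
  then have "(\<Sum>z\<in>Q. s * char_sum N z) = (s * s) * (2 ^ (h * k + h) * int M)"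
    by (simp flip: sum_distrib_left)
  also have "\<dots> = (\<Sum>z\<in>Q. 2 ^ (h * k))"
    by (simp add: ss card_Q power_add)
  \<comment> \<open>Termwise bounds with equal totals are equalities.\<close>
  finally have eq: "s * char_sum N z = 2 ^ (h * k)" if "z \<in> Q" for z
    using le that by (rule sum_mono_inv) auto
  have "char_sum N z = s * 2 ^ (h * k)" if "z \<in> Q" for z
    using arg_cong[OF eq[OF that], of "(*) s"] ss by (simp flip: mult.assoc)
  with power[of x] \<open>x \<noteq> 0\<close> show ?thesis
    by (auto simp: P_def Q_def N_def s_def)
qed

end

section \<open>The weight distribution\<close>

text \<open>The case \<open>h = e\<close> is excluded: there \<open>w2\<close> would be 0, so
  nonzero \<open>x\<close> would give the zero codeword.\<close>

theorem theorem5: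
  fixes m h e :: nat
    and d :: "'n :: finite \<Rightarrow> 'a :: finite_field"
  assumes "m > 2" and "0 < h" and "h < m" and "h dvd m" and "even (m div h)"
    and "m = 2 * e"
    and "h \<noteq> e"
    and "CARD('a) = 2 ^ m"
    and "bij_betw d UNIV (UNIV - {0})"
  shows "let C = trace_code m h d;
             w1 = 2 ^ (m - 1) - (- 1) ^ (e div h) * 2 ^ (e - 1) :: int;
             w2 = 2 ^ (m - 1) + (- 1) ^ (e div h) * 2 ^ (e + h - 1) :: int
         in linear_code C (2 ^ m - 1) m \<and>
            weight_multiplicity C 0 = 1 \<and>
            real (weight_multiplicity C w1) = (2 ^ m - 1) * 2 ^ h / (2 ^ h + 1) \<and>
            real (weight_multiplicity C w2) = (2 ^ m - 1) / (2 ^ h + 1) \<and>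
            (\<forall>w. w \<notin> {0, w1, w2} \<longrightarrow> weight_multiplicity C w = 0)"
proof -
  interpret binary_field m "TYPE('a)" by standard fact
  have "2 dvd m div h" using assms(5) .
  then obtain k where "m div h = 2 * k" by (rule dvdE)
  then have "2 * e = h * (2 * k)"
    using assms(4,6) by (metis dvd_mult_div_cancel)
  then have e: "e = h * k" by simp
  have "k \<noteq> 0" "k \<noteq> 1" using assms(1,6,7) e by (auto intro: gr0I)
  then have k: "k \<ge> 2" by simp
  have "h < e" using k assms(2) mult_le_mono2[OF k, of h] by (simp add: e)
  have k_eq: "e div h = k" using assms(2) by (simp add: e)
  have m: "m = 2 * (h * k)" using assms(6) e by simp

  define N :: nat where "N = 2 ^ h + 1"
  \<comment> \<open>\<open>N\<close> divides \<open>2 ^ m - 1\<close> because it divides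
    \<open>2 ^ (2 * h) - 1\<close> and \<open>2 * h\<close> divides \<open>m\<close>.\<close>
  have "N * (2 ^ h - 1) = (2 ^ h * 2 ^ h) - (1 :: nat)"
    by (simp add: N_def algebra_simps)
  then have "N dvd 2 ^ h * 2 ^ h - 1" by (metis dvd_triv_left)
  also have "2 ^ h * 2 ^ h - 1 dvd (2 ^ h * 2 ^ h) ^ k - (1 :: nat)"
    by (rule power_minus_1_dvd)
  also have "(2 ^ h * 2 ^ h) ^ k = (2 :: nat) ^ m"
    by (simp add: m mult.commute mult_2 flip: power_mult power_add)
  finally obtain M where NM: "2 ^ m - 1 = N * M" by (rule dvdE)
  have NM': "(2 ^ h + 1) * M = 2 ^ m - (1 :: nat)" using NM by (simp add: N_def)
  have NM_card: "N * M = CARD('a) - 1" using NM assms(8) by simp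
  then have M_pos: "M > 0" using card_gt_1 by (intro gr0I) simp
  have M_eq: "real M = (2 ^ m - 1) / (2 ^ h + 1)"
  proof -
    have "2 ^ m - 1 = real N * real M"
      using arg_cong[OF NM, of real] by (simp add: of_nat_diff)
    moreover have "real N > 0" by (simp add: N_def add_pos_pos)
    ultimately have "real M = (2 ^ m - 1) / real N" by simp
    then show ?thesis by (simp add: N_def add.commute)
  qed

  define s :: int where "s = (- 1) ^ k"
  have s: "s = 1 \<or> s = - 1" by (cases "even k") (auto simp: s_def)
  define w1 :: int where "w1 = 2 ^ (m - 1) - s * 2 ^ (e - 1)"
  define w2 :: int where "w2 = 2 ^ (m - 1) + s * 2 ^ (e + h - 1)"
  \<comment> \<open>The second bound rests on \<open>h < e\<close> and keeps \<open>w2\<close> away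
    from 0.\<close>
  have "(2 :: int) ^ (e - 1) < 2 ^ (e + h - 1)" "(2 :: int) ^ (e + h - 1) < 2 ^ (m - 1)"
    using \<open>h < e\<close> assms(2,6) by (auto intro!: power_strict_increasing)
  moreover have "(0 :: int) < 2 ^ (e - 1)" by simp
  ultimately have w: "w1 \<noteq> 0 \<and> w2 \<noteq> 0 \<and> w1 \<noteq> w2"
    using s unfolding w1_def w2_def
    by (intro conjI; elim disjE; simp only: mult_1 mult_minus1; linarith)
  have double: "2 * (2 :: int) ^ (n - 1) = 2 ^ n" if "n > 0" for n
    using that by (simp flip: power_Suc)

  define cw :: "'a \<Rightarrow> bit ^ 'n" where "cw x = (\<chi> j. abs_trace m (x * d j ^ N))" for x
  define W where "W x = int (hamming_weight (cw x))" for x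
  have C: "trace_code m h d = range cw"
    by (simp add: trace_code_def cw_def N_def)
  have card_n: "CARD('n) = 2 ^ m - 1"
    using bij_betw_same_card[OF assms(9)] by (simp add: card_Diff_singleton assms(8))

  \<comment> \<open>A coordinate contributes 1 or -1 to the sum over \<open>D\<close>. The missing
    term \<open>y = 0\<close> and the length \<open>2 ^ m - 1\<close> each account for a 1, and
    these cancel.\<close>
  have W_char_sum: "2 * W x = 2 ^ m - char_sum N x" for x
  proof -
    have "(\<Sum>j\<in>UNIV. chi (x * d j ^ N)) = (\<Sum>y\<in>UNIV - {0}. chi (x * y ^ N))"
      by (rule sum.reindex_bij_betw[OF assms(9)])
    also have "\<dots> = char_sum N x - 1"
      by (simp add: char_sum_def sum.remove[of UNIV 0] N_def)
    also have "(\<Sum>j\<in>UNIV. chi (x * d j ^ N)) = (\<Sum>j\<in>UNIV. 1 - 2 * of_bool (cw x $ j \<noteq> 0))"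
      by (intro sum.cong) (auto simp: chi_def cw_def)
    also have "\<dots> = int CARD('n) - 2 * W x"
      by (simp add: sum_subtractf W_def hamming_weight_def flip: sum_distrib_left)
    finally show ?thesis by (simp add: card_n of_nat_diff)
  qed
  have W_0: "W 0 = 0"
    using W_char_sum[of 0] by (simp add: char_sum_0)
  have S_eq: "char_sum N x = (if x ^ M = 1 then - (s * 2 ^ (e + h)) else s * 2 ^ e)"
    if "x \<noteq> 0" for x
    unfolding N_def s_def e using assms(2) k that by (intro char_sum_eq[OF m _ _ NM']) auto
  have double_w: "2 * w1 = 2 ^ m - s * 2 ^ e" "2 * w2 = 2 ^ m + s * 2 ^ (e + h)"
    using s double[of m] double[of e] double[of "e + h"] m_pos \<open>h < e\<close>
    by (auto simp: w1_def w2_def algebra_simps)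
  have W_power: "W x = w2" if "x ^ M = 1" for x
  proof -
    have "x \<noteq> 0" using that M_pos by (auto simp: power_0_left)
    then show ?thesis using W_char_sum[of x] S_eq[of x] double_w that by simp
  qed
  have W_non_power: "W x = w1" if "x \<noteq> 0" "x ^ M \<noteq> 1" for x
    using W_char_sum[of x] S_eq[of x] double_w that by simp

  have cw_add: "cw (x + y) = cw x + cw y" for x y
    by (simp add: cw_def vec_eq_iff distrib_right abs_trace_add)
  have cw_0: "cw 0 = 0" using cw_add[of 0 0] by simp
  \<comment> \<open>By additivity it suffices that nonzero \<open>x\<close> give nonzero weights;
    the code then has \<open>2 ^ m\<close> words, and weights can be counted over
    \<open>x\<close>.\<close>
  have inj: "inj cw"
  proof (rule injI)
    fix x y assume "cw x = cw y"
    then have "cw (x - y) = 0" using cw_add[of "x - y" y] by simp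
    then have "W (x - y) = 0" by (simp add: W_def hamming_weight_def)
    then show "x = y" using W_power[of "x - y"] W_non_power[of "x - y"] w by auto
  qed
  have subspace: "vec.subspace (range cw)"
  proof (rule vec.subspaceI)
    show "0 \<in> range cw" using cw_0 by (metis rangeI)
    show "v + w \<in> range cw" if "v \<in> range cw" "w \<in> range cw" for v w
      using that by (auto simp flip: cw_add)
    show "c *s v \<in> range cw" if "v \<in> range cw" for c v
      using that \<open>0 \<in> range cw\<close> by (cases c) auto
  qed
  have "2 ^ vec.dim (range cw) = (2 :: nat) ^ m"
    using card_subspace_bit[OF subspace] card_image[OF inj] by (simp add: assms(8))
  then have code: "linear_code (range cw) (2 ^ m - 1) m"
    using subspace card_n by (simp add: linear_code_def)

  have mult: "weight_multiplicity (range cw) w = card {x. W x = w}" for w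
  proof -
    have "{c \<in> range cw. int (hamming_weight c) = w} = cw ` {x. W x = w}"
      by (auto simp: W_def)
    then show ?thesis
      using inj by (simp add: weight_multiplicity_def card_image inj_on_subset)
  qed
  define P where "P = {x :: 'a. x ^ M = 1}"
  have "0 \<notin> P" using M_pos by (auto simp: P_def power_0_left)
  have card_P: "card P = M"
    unfolding P_def using NM_card card_gt_1 by (intro card_power_eq_1[OF NM_card]) linarith
  have W_eq: "W x = (if x = 0 then 0 else if x \<in> P then w2 else w1)" for x
    using W_0 W_power W_non_power by (auto simp: P_def)
  have "{x. W x = 0} = {0}" "{x. W x = w2} = P" "{x. W x = w1} = UNIV - {0} - P"
    using w \<open>0 \<notin> P\<close> by (auto simp: W_eq split: if_splits)
  moreover have "card (UNIV - {0} - P) = 2 ^ h * M"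
    unfolding P_def by (rule card_non_powers[OF NM'])
  moreover have "{x. W x = w} = {}" if "w \<notin> {0, w1, w2}" for w
    using that by (auto simp: W_eq split: if_splits)
  ultimately have "weight_multiplicity (range cw) 0 = 1 \<and>
      real (weight_multiplicity (range cw) w1) = (2 ^ m - 1) * 2 ^ h / (2 ^ h + 1) \<and>
      real (weight_multiplicity (range cw) w2) = (2 ^ m - 1) / (2 ^ h + 1) \<and>
      (\<forall>w. w \<notin> {0, w1, w2} \<longrightarrow> weight_multiplicity (range cw) w = 0)"
    by (simp add: mult card_P M_eq)
  with code show ?thesis
    unfolding Let_def C k_eq w1_def w2_def s_def by (intro conjI) blast+
qed

end
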